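(* (The first form of the Fundamental Theorem of Calculus with specular derivatives.) Suppose $f:[a,b]\to\mathbb{R}$ is a piecewise continuous function with singular set $\mathcal{S}$. If there exists $F:[a,b]\to\mathbb{R}$ such that (i) $F$ is continuous on $[a,b]$, and (ii) $F^{\wedge}(x)=f(x)$ for all $x\in[a,b]\setminus\mathcal{S}$, where $F^{\wedge}$ denotes the specular derivative of $F$, then $$\int_a^b f(x)\,dx=F(b)-F(a).$$
   Context: One-sided limits: for a function $g$ of one real variable, $g[x):=\lim_{h\searrow 0}g(x+h)$ and $g(x]:=\lim_{h\nearrow 0}g(x+h)$ (when the limits exist as real numbers). Piecewise continuity: $f:[a,b]\to\mathbb{R}$ is piecewise continuous with singular set $\mathcal{S}$ if $\mathcal{S}=\{s_1<\dots<s_n\}\subset(a,b)$ is a finite (possibly empty) set, $f$ is continuous on $[a,b]\setminus\mathcal{S}$, and at each $s\in\mathcal{S}$ both one-sided limits $f(s]$ and $f[s)$ exist as real numbers with $f(s]\neq f[s)$ (a jump discontinuity; the points of $\mathcal{S}$ are called singular points). Specular derivative: the right and left specular derivatives of $F$ at $x$ are $$F^{\wedge}_+(x)=\lim_{h\searrow0}\frac{F(x+h)-F[x)}{h},\qquad F^{\wedge}_-(x)=\lim_{h\nearrow0}\frac{F(x+h)-F(x]}{h}$$ (as real numbers). $F$ is specularly differentiable at an interior point $x$ if both exist and $F[x)=F(x]$ (automatic when $F$ is continuous at $x$). Writing $\alpha=F^{\wedge}_+(x)$, $\beta=F^{\wedge}_-(x)$, the specular derivative is $$F^{\wedge}(x)=\begin{cases}\dfrac{\alpha\beta-1+\sqrt{(\alpha^2+1)(\beta^2+1)}}{\alpha+\beta}&\text{if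 }\alpha+\beta\neq0,\\ 0&\text{if }\alpha+\beta=0,\end{cases}$$ equivalently $F^{\wedge}(x)=\tan\left(\frac{\arctan\alpha+\arctan\beta}{2}\right)$. At the endpoints, $F^{\wedge}(a)=F^{\wedge}_+(a)$ and $F^{\wedge}(b)=F^{\wedge}_-(b)$. *)

theory Defs
  imports "HOL-Analysis.Analysis"
begin

text \<open>
  A function on a closed interval is represented by a total function on the reals; none of the
  notions below depends on its values outside the interval.
\<close>

definition piecewise_continuous_on :: "real \<Rightarrow> real \<Rightarrow> real set \<Rightarrow> (real \<Rightarrow> real) \<Rightarrow> bool" where
  "piecewise_continuous_on a b S f \<longleftrightarrow>
     finite S \<and> S \<subseteq> {a<..<b} \<and> continuous_on ({a..b} - S) f \<and>
     (\<forall>s\<in>S. \<exists>l r. (f \<longlongrightarrow> l) (at_left s) \<and> (f \<longlongrightarrow> r) (at_right s) \<and> l \<noteq> r)"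

text \<open>
  The one-sided specular derivatives subtract the one-sided limit \<open>L\<close> of \<open>F\<close> at \<open>x\<close>, not the
  value \<open>F x\<close>.
\<close>

definition has_right_specular_derivative :: "(real \<Rightarrow> real) \<Rightarrow> real \<Rightarrow> real \<Rightarrow> bool" where
  "has_right_specular_derivative F \<alpha> x \<longleftrightarrow>
     (\<exists>L. (F \<longlongrightarrow> L) (at_right x) \<and> ((\<lambda>h. (F (x + h) - L) / h) \<longlongrightarrow> \<alpha>) (at_right 0))"

definition has_left_specular_derivative :: "(real \<Rightarrow> real) \<Rightarrow> real \<Rightarrow> real \<Rightarrow> bool" where
  "has_left_specular_derivative F \<beta> x \<longleftrightarrow>
     (\<exists>L. (F \<longlongrightarrow> L) (at_left x) \<and> ((\<lambda>h. (F (x + h) - L) / h) \<longlongrightarrow> \<beta>) (at_left 0))"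

definition specular_slope :: "real \<Rightarrow> real \<Rightarrow> real" where
  "specular_slope \<alpha> \<beta> =
     (if \<alpha> + \<beta> \<noteq> 0 then (\<alpha> * \<beta> - 1 + sqrt ((\<alpha>\<^sup>2 + 1) * (\<beta>\<^sup>2 + 1))) / (\<alpha> + \<beta>) else 0)"

text \<open>
  \<open>has_specular_derivative_on a b F D x\<close>: the function \<open>F\<close> on \<open>[a, b]\<close> has specular derivative \<open>D\<close>
  at \<open>x\<close>.  At an interior point this includes specular differentiability, that is, existence of
  both one-sided derivatives and equality of the two one-sided limits of \<open>F\<close>.
\<close>

definition has_specular_derivative_on ::
    "real \<Rightarrow> real \<Rightarrow> (real \<Rightarrow> real) \<Rightarrow> real \<Rightarrow> real \<Rightarrow> bool" where
  "has_specular_derivative_on a b F D x \<longleftrightarrow>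
     (x = a \<and> has_right_specular_derivative F D x) \<or>
     (x = b \<and> has_left_specular_derivative F D x) \<or>
     (a < x \<and> x < b \<and>
      (\<exists>L. (F \<longlongrightarrow> L) (at_right x) \<and> (F \<longlongrightarrow> L) (at_left x)) \<and>
      (\<exists>\<alpha> \<beta>. has_right_specular_derivative F \<alpha> x \<and> has_left_specular_derivative F \<beta> x \<and>
             D = specular_slope \<alpha> \<beta>))"

lemma has_right_specular_derivative_unique:
  assumes "has_right_specular_derivative F \<alpha> x" "has_right_specular_derivative F \<alpha>' x"
  shows "\<alpha> = \<alpha>'"
  using assms unfolding has_right_specular_derivative_def
  by (metis tendsto_unique trivial_limit_at_right_real)

lemma has_left_specular_derivative_unique:
  assumes "has_left_specular_derivative F \<beta> x" "has_left_specular_derivative F \<beta>' x"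
  shows "\<beta> = \<beta>'"
  using assms unfolding has_left_specular_derivative_def
  by (metis tendsto_unique trivial_limit_at_left_real)

lemma has_specular_derivative_on_unique:
  assumes "a < b" "has_specular_derivative_on a b F D x" "has_specular_derivative_on a b F D' x"
  shows "D = D'"
  using assms unfolding has_specular_derivative_on_def
  by (auto dest: has_right_specular_derivative_unique has_left_specular_derivative_unique)

end

theory Submission
  imports Defs
begin

text \<open>
  The specular derivative lies between the two one-sided derivatives, so wherever it exceeds \<open>m\<close>
  at least one of them does. This already bounds increments of a continuous \<open>F\<close> from below by
  \<open>m\<close> times the length: otherwise \<open>G t = F t - m * t\<close> would cross some intermediate level
  downwards, and at the first point after which \<open>G\<close> drops below that level neither one-sided
  derivative of \<open>G\<close> is positive. Together with the symmetric upper bound, continuity of \<open>f\<close> away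
  from the singular set makes \<open>F\<close> differentiable there with derivative \<open>f\<close> in the ordinary sense,
  and the classical fundamental theorem with finitely many exceptional points applies.
\<close>

section \<open>Comparing the specular slope with the one-sided slopes\<close>

lemma specular_slope_commute: "specular_slope \<alpha> \<beta> = specular_slope \<beta> \<alpha>"
  by (simp add: specular_slope_def mult.commute add.commute)

text \<open>Changing both signs keeps the numerator and negates the denominator. This lets upper
  bounds for \<open>F\<close> follow from lower bounds for \<open>-F\<close>.\<close>

lemma specular_slope_minus: "specular_slope (- \<alpha>) (- \<beta>) = - specular_slope \<alpha> \<beta>"
proof (cases "\<alpha> + \<beta> = 0")
  case True
  then show ?thesis by (simp add: specular_slope_def)
next
  case False
  have "- \<alpha> + - \<beta> = - (\<alpha> + \<beta>)" by simp
  then show ?thesis using False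
    unfolding specular_slope_def by (simp only: divide_minus_right) simp
qed

text \<open>After multiplication by \<alpha> + \<beta> the claim compares the square root with
  \<open>\<beta>\<^sup>2 + 1\<close>. If the sum is positive, then |\<alpha>| \<le> |\<beta>| and
  the root is the smaller one; if it is negative, both comparisons reverse, and so does the
  inequality on division.\<close>

lemma specular_slope_le_right:
  assumes "\<alpha> \<le> \<beta>"
  shows "specular_slope \<alpha> \<beta> \<le> \<beta>"
proof -
  consider "\<alpha> + \<beta> = 0" | "\<alpha> + \<beta> > 0" | "\<alpha> + \<beta> < 0" by linarith
  then show ?thesis
  proof cases
    case 1
    with assms show ?thesis by (simp add: specular_slope_def)
  next
    case 2
    have "\<alpha>\<^sup>2 \<le> \<beta>\<^sup>2" using assms 2 by (simp add: abs_le_square_iff[symmetric])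
    then have "sqrt ((\<alpha>\<^sup>2 + 1) * (\<beta>\<^sup>2 + 1)) \<le> \<beta>\<^sup>2 + 1"
      by (intro real_le_lsqrt) (auto simp: power2_eq_square[of "\<beta>\<^sup>2 + 1"] intro: mult_right_mono)
    with 2 show ?thesis
      by (simp add: specular_slope_def pos_divide_le_eq) (simp add: power2_eq_square algebra_simps)
  next
    case 3
    have "\<beta>\<^sup>2 \<le> \<alpha>\<^sup>2" using assms 3 by (simp add: abs_le_square_iff[symmetric])
    then have "\<beta>\<^sup>2 + 1 \<le> sqrt ((\<alpha>\<^sup>2 + 1) * (\<beta>\<^sup>2 + 1))"
      by (intro real_le_rsqrt) (auto simp: power2_eq_square[of "\<beta>\<^sup>2 + 1"] intro: mult_right_mono)
    with 3 show ?thesis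
      by (simp add: specular_slope_def neg_divide_le_eq) (simp add: power2_eq_square algebra_simps)
  qed
qed

lemma specular_slope_le_max: "specular_slope \<alpha> \<beta> \<le> max \<alpha> \<beta>"
  using specular_slope_le_right[of \<alpha> \<beta>] specular_slope_le_right[of \<beta> \<alpha>]
  by (cases "\<alpha> \<le> \<beta>") (auto simp: specular_slope_commute)

section \<open>One-sided specular derivatives at points of continuity\<close>

lemma has_right_specular_derivative_iff:
  assumes "(F \<longlongrightarrow> F x) (at_right x)"
  shows "has_right_specular_derivative F \<alpha> x \<longleftrightarrow>
    ((\<lambda>h. (F (x + h) - F x) / h) \<longlongrightarrow> \<alpha>) (at_right 0)"
  unfolding has_right_specular_derivative_def
  using assms by (auto dest: tendsto_unique[OF trivial_limit_at_right_real assms])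

lemma has_left_specular_derivative_iff:
  assumes "(F \<longlongrightarrow> F x) (at_left x)"
  shows "has_left_specular_derivative F \<beta> x \<longleftrightarrow>
    ((\<lambda>h. (F (x + h) - F x) / h) \<longlongrightarrow> \<beta>) (at_left 0)"
  unfolding has_left_specular_derivative_def
  using assms by (auto dest: tendsto_unique[OF trivial_limit_at_left_real assms])

lemma has_right_specular_derivative_minus:
  assumes "has_right_specular_derivative F \<alpha> x"
  shows "has_right_specular_derivative (\<lambda>t. - F t) (- \<alpha>) x"
proof -
  from assms obtain L where L: "(F \<longlongrightarrow> L) (at_right x)"
    "((\<lambda>h. (F (x + h) - L) / h) \<longlongrightarrow> \<alpha>) (at_right 0)"
    unfolding has_right_specular_derivative_def by blast
  have "((\<lambda>h. (- F (x + h) - - L) / h) \<longlongrightarrow> - \<alpha>) (at_right 0)"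
    using tendsto_minus[OF L(2)] by (simp add: diff_divide_distrib)
  with tendsto_minus[OF L(1)] show ?thesis
    unfolding has_right_specular_derivative_def by blast
qed

lemma has_left_specular_derivative_minus:
  assumes "has_left_specular_derivative F \<beta> x"
  shows "has_left_specular_derivative (\<lambda>t. - F t) (- \<beta>) x"
proof -
  from assms obtain L where L: "(F \<longlongrightarrow> L) (at_left x)"
    "((\<lambda>h. (F (x + h) - L) / h) \<longlongrightarrow> \<beta>) (at_left 0)"
    unfolding has_left_specular_derivative_def by blast
  have "((\<lambda>h. (- F (x + h) - - L) / h) \<longlongrightarrow> - \<beta>) (at_left 0)"
    using tendsto_minus[OF L(2)] by (simp add: diff_divide_distrib)
  with tendsto_minus[OF L(1)] show ?thesis
    unfolding has_left_specular_derivative_def by blast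
qed

lemma has_right_specular_derivative_gt:
  assumes "has_right_specular_derivative F \<alpha> x" "(F \<longlongrightarrow> F x) (at_right x)" "m < \<alpha>"
  shows "\<forall>\<^sub>F t in at_right x. F x - m * x < F t - m * t"
proof -
  have "\<forall>\<^sub>F h in at_right 0. m < (F (x + h) - F x) / h"
    using assms by (auto simp: has_right_specular_derivative_iff intro: order_tendstoD(1))
  \<comment> \<open>Clearing the positive denominator \<open>h\<close> turns the bound on the
    quotient into growth of \<open>F t - m * t\<close> to the right.\<close>
  then have "\<forall>\<^sub>F h in at_right 0. F x - m * x < F (h + x) - m * (h + x)"
    using eventually_at_right_less[of 0]
    by eventually_elim (simp add: field_simps)
  then show ?thesis
    by (simp add: eventually_at_right_to_0[of _ x])
qed

lemma has_left_specular_derivative_gt: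
  assumes "has_left_specular_derivative F \<beta> x" "(F \<longlongrightarrow> F x) (at_left x)" "m < \<beta>"
  shows "\<forall>\<^sub>F t in at_left x. F t - m * t < F x - m * x"
proof -
  have "\<forall>\<^sub>F h in at_left 0. m < (F (x + h) - F x) / h"
    using assms by (auto simp: has_left_specular_derivative_iff intro: order_tendstoD(1))
  moreover have "\<forall>\<^sub>F h in at_left (0::real). h < 0"
    by (auto simp: eventually_at_filter)
  \<comment> \<open>Here \<open>h\<close> is negative, so clearing the denominator reverses the
    inequality: values to the left of \<open>x\<close> lie below the value at
    \<open>x\<close>.\<close>
  ultimately have "\<forall>\<^sub>F h in at_left 0. F (h + x) - m * (h + x) < F x - m * x"
    by eventually_elim (simp add: field_simps)
  \<comment> \<open>The translation by \<open>x\<close> is written as subtraction of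
    \<open>- x\<close> to fit the form of \<open>filtermap_nhds_shift\<close>.\<close>
  moreover have "filtermap (\<lambda>h. h - (- x)) (at_left 0) = at_left (0 - (- x))"
    by (simp only: filter_eq_iff eventually_filtermap eventually_at_filter
        filtermap_nhds_shift[symmetric]) simp
  then have "at_left x = filtermap (\<lambda>h. h + x) (at_left 0)" by simp
  ultimately show ?thesis
    by (simp add: eventually_filtermap)
qed

section \<open>From one-sided growth to bounds on increments\<close>

lemma le_if_locally_increasing_on_one_side:
  fixes G :: "real \<Rightarrow> real"
  assumes "c \<le> d" and cont: "continuous_on {c..d} G"
    and incr: "\<And>x. x \<in> {c<..<d} \<Longrightarrow>
      (\<forall>\<^sub>F t in at_left x. G t < G x) \<or> (\<forall>\<^sub>F t in at_right x. G x < G t)"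
  shows "G c \<le> G d"
proof (rule ccontr)
  assume "\<not> G c \<le> G d"
  then obtain y where y: "G d < y" "y < G c" using dense[of "G d" "G c"] by auto
  define A where "A = {t \<in> {c..d}. G t < y}"
  define x where "x = Inf A"
  have "d \<in> A" using y \<open>c \<le> d\<close> by (simp add: A_def)
  have bdd: "bdd_below A" by (auto simp: A_def intro: bdd_belowI[of _ c])
  have "x \<in> closure A" unfolding x_def using \<open>d \<in> A\<close> bdd by (intro closure_contains_Inf) auto
  \<comment> \<open>By continuity a limit of points of \<open>A\<close> still has value at most
    \<open>y\<close>.\<close>
  moreover have "closed {t \<in> {c..d}. G t \<le> y}"
    using cont continuous_closed_preimage[of "{c..d}" G "{..y}"]
    by (auto simp: vimage_def Int_def)
  then have "closure A \<subseteq> {t \<in> {c..d}. G t \<le> y}"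
    by (intro closure_minimal) (auto simp: A_def)
  ultimately have x: "x \<in> {c..d}" "G x \<le> y" by auto
  have before: "y \<le> G t" if "t \<in> {c..<x}" for t
    using that cInf_lower[OF _ bdd, of t] x by (force simp: A_def x_def)
  have "c < x" using x y by (cases "x = c") auto
  \<comment> \<open>The bound \<open>y \<le> G t\<close> left of \<open>x\<close> passes to the
    closure and so holds at \<open>x\<close> too, which forces \<open>G x = y\<close>.\<close>
  have "{c..x} = closure {c..<x}" using \<open>c < x\<close> by simp
  also have "closed {t \<in> {c..d}. y \<le> G t}"
    using cont continuous_closed_preimage[of "{c..d}" G "{y..}"]
    by (auto simp: vimage_def Int_def)
  then have "closure {c..<x} \<subseteq> {t \<in> {c..d}. y \<le> G t}"
    using before x by (intro closure_minimal) auto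
  finally have "{c..x} \<subseteq> {t \<in> {c..d}. y \<le> G t}" .
  then have "x \<in> {t \<in> {c..d}. y \<le> G t}" using \<open>c < x\<close> by (auto dest!: subsetD[where c = x])
  then have "G x = y" using x by auto
  then have "x < d" using x y by (cases "x = d") auto
  with incr[of x] \<open>c < x\<close> \<open>G x = y\<close>
  consider "\<forall>\<^sub>F t in at_left x. G t < y" | "\<forall>\<^sub>F t in at_right x. y < G t" by auto
  then show False
  proof cases
    \<comment> \<open>Values below \<open>y\<close> just left of \<open>x\<close> would be points of
      \<open>A\<close> below its infimum.\<close>
    case 1
    moreover have "\<forall>\<^sub>F t in at_left x. t \<in> {c<..<x}"
      using \<open>c < x\<close> by (rule eventually_at_left_real)
    ultimately have "\<forall>\<^sub>F t in at_left x. False"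
    proof eventually_elim
      case (elim t)
      then show False using before[of t] by auto
    qed
    then show False by simp
  next
    case 2
    then obtain z where z: "x < z" "\<And>t. x < t \<Longrightarrow> t < z \<Longrightarrow> y < G t"
      by (auto simp: eventually_at_right_field)
    \<comment> \<open>Since \<open>G x = y\<close>, the point \<open>x\<close> is not in
      \<open>A\<close>. Growth to the right keeps \<open>A\<close> out of the interval from
      \<open>x\<close> to \<open>z\<close> as well, so \<open>z\<close> would be a lower bound of
      \<open>A\<close> greater than its infimum.\<close>
    have "z \<le> t" if "t \<in> A" for t
    proof -
      have "x \<le> t" "G t < y"
        using that cInf_lower[OF that bdd] by (auto simp: A_def x_def)
      with \<open>G x = y\<close> have "x < t" by (cases "t = x") auto
      with z(2)[of t] \<open>G t < y\<close> show ?thesis by linarith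
    qed
    then have "z \<le> x" unfolding x_def using \<open>d \<in> A\<close> by (intro cInf_greatest) auto
    with z show False by simp
  qed
qed

text \<open>A specular slope above \<open>m\<close> forces \<alpha> or \<beta> above
  \<open>m\<close>, strictly, so \<open>F t - m * t\<close> grows on at least one side of each
  interior point.\<close>

lemma specular_increment_ge:
  assumes "c \<le> d" and cont: "continuous_on {c..d} F"
    and deriv: "\<And>x. x \<in> {c<..<d} \<Longrightarrow> \<exists>\<alpha> \<beta>. has_right_specular_derivative F \<alpha> x \<and>
      has_left_specular_derivative F \<beta> x \<and> m < specular_slope \<alpha> \<beta>"
  shows "m * (d - c) \<le> F d - F c"
proof -
  have "F c - m * c \<le> F d - m * d"
  proof (rule le_if_locally_increasing_on_one_side[OF \<open>c \<le> d\<close>])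
    show "continuous_on {c..d} (\<lambda>t. F t - m * t)" by (intro continuous_intros cont)
  next
    fix x assume x: "x \<in> {c<..<d}"
    then obtain \<alpha> \<beta> where 1: "has_right_specular_derivative F \<alpha> x"
      "has_left_specular_derivative F \<beta> x" "m < specular_slope \<alpha> \<beta>"
      using deriv by blast
    have "isCont F x" using cont x by (simp add: continuous_on_interior)
    then have "(F \<longlongrightarrow> F x) (at_left x)" "(F \<longlongrightarrow> F x) (at_right x)"
      by (simp_all add: isCont_def filterlim_at_split)
    moreover have "m < \<alpha> \<or> m < \<beta>" using 1(3) specular_slope_le_max[of \<alpha> \<beta>] by auto
    ultimately show "(\<forall>\<^sub>F t in at_left x. F t - m * t < F x - m * x) \<or>
        (\<forall>\<^sub>F t in at_right x. F x - m * x < F t - m * t)"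
      using 1 has_right_specular_derivative_gt has_left_specular_derivative_gt by blast
  qed
  then show ?thesis by (simp add: algebra_simps)
qed

text \<open>This is the lower bound applied to \<open>-F\<close> and \<open>-M\<close>.\<close>

lemma specular_increment_le:
  assumes "c \<le> d" and cont: "continuous_on {c..d} F"
    and deriv: "\<And>x. x \<in> {c<..<d} \<Longrightarrow> \<exists>\<alpha> \<beta>. has_right_specular_derivative F \<alpha> x \<and>
      has_left_specular_derivative F \<beta> x \<and> specular_slope \<alpha> \<beta> < M"
  shows "F d - F c \<le> M * (d - c)"
proof -
  have "\<exists>\<alpha> \<beta>. has_right_specular_derivative (\<lambda>t. - F t) \<alpha> x \<and>
      has_left_specular_derivative (\<lambda>t. - F t) \<beta> x \<and> - M < specular_slope \<alpha> \<beta>"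
    if "x \<in> {c<..<d}" for x
  proof -
    from deriv[OF that] obtain \<alpha> \<beta> where "has_right_specular_derivative F \<alpha> x"
      "has_left_specular_derivative F \<beta> x" "specular_slope \<alpha> \<beta> < M" by blast
    then show ?thesis
      by (intro exI[of _ "- \<alpha>"] exI[of _ "- \<beta>"])
        (simp add: has_right_specular_derivative_minus has_left_specular_derivative_minus
          specular_slope_minus)
  qed
  from specular_increment_ge[OF \<open>c \<le> d\<close> _ this] cont show ?thesis
    by (simp add: continuous_on_minus)
qed

text \<open>Near \<open>x\<close> all specular slopes are within \<open>e\<close> of
  \<open>f x\<close>. The two increment bounds carry this over to difference quotients, which gives
  the epsilon-delta form of differentiability.\<close>

lemma has_real_derivative_if_continuous_specular_derivative:
  assumes "open U" "x \<in> U" and contF: "continuous_on U F" and contf: "isCont f x"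
    and deriv: "\<And>t. t \<in> U \<Longrightarrow> \<exists>\<alpha> \<beta>. has_right_specular_derivative F \<alpha> t \<and>
      has_left_specular_derivative F \<beta> t \<and> f t = specular_slope \<alpha> \<beta>"
  shows "(F has_real_derivative f x) (at x)"
  unfolding has_field_derivative_def has_derivative_at_alt
proof (intro conjI allI impI)
  show "bounded_linear ((*) (f x))" by (rule bounded_linear_mult_right)
next
  fix e :: real assume "0 < e"
  with contf obtain r where r: "0 < r" "\<And>t. dist t x < r \<Longrightarrow> dist (f t) (f x) < e"
    unfolding continuous_at_eps_delta by blast
  from \<open>open U\<close> \<open>x \<in> U\<close> obtain s where s: "0 < s" "ball x s \<subseteq> U"
    by (meson openE)
  \<comment> \<open>The radius \<open>r\<close> keeps \<open>f\<close> close to \<open>f x\<close>,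
    and \<open>s\<close> keeps the interval inside \<open>U\<close>.\<close>
  define \<delta> where "\<delta> = min r s"
  \<comment> \<open>Stated for any ordered pair \<open>u \<le> v\<close>, so that \<open>x\<close>
    can serve as the left or the right endpoint.\<close>
  have bounds: "\<bar>F v - F u - f x * (v - u)\<bar> \<le> e * (v - u)"
    if uv: "u \<le> v" "u \<in> ball x \<delta>" "v \<in> ball x \<delta>" for u v
  proof -
    have sub: "{u..v} \<subseteq> ball x \<delta>"
      using uv by (auto simp: dist_real_def)
    also have "\<dots> \<subseteq> ball x s" by (auto simp: \<delta>_def)
    finally have "{u..v} \<subseteq> U" using s by blast
    then have cont: "continuous_on {u..v} F" using contF continuous_on_subset by blast
    have slopes: "\<exists>\<alpha> \<beta>. has_right_specular_derivative F \<alpha> t \<and> has_left_specular_derivative F \<beta> t \<and>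
        f x - e < specular_slope \<alpha> \<beta> \<and> specular_slope \<alpha> \<beta> < f x + e" if "t \<in> {u<..<v}" for t
    proof -
      have "t \<in> {u..v}" using that by simp
      then have "t \<in> U" "dist t x < r"
        using \<open>{u..v} \<subseteq> U\<close> sub by (auto simp: \<delta>_def dist_commute)
      then have "f x - e < f t \<and> f t < f x + e"
        using r(2)[of t] by (auto simp: dist_real_def)
      then show ?thesis using deriv[OF \<open>t \<in> U\<close>] by fastforce
    qed
    have "(f x - e) * (v - u) \<le> F v - F u"
      by (rule specular_increment_ge[OF uv(1) cont]) (use slopes in blast)
    moreover have "F v - F u \<le> (f x + e) * (v - u)"
      by (rule specular_increment_le[OF uv(1) cont]) (use slopes in blast)
    ultimately show ?thesis by (simp add: abs_le_iff algebra_simps)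
  qed
  have "norm (F t - F x - f x * (t - x)) \<le> e * norm (t - x)" if t: "norm (t - x) < \<delta>" for t
  proof (cases "x \<le> t")
    case True
    then show ?thesis using bounds[of x t] t by (auto simp: dist_real_def)
  next
    case False
    have "F t - F x - f x * (t - x) = - (F x - F t - f x * (x - t))"
      by (simp add: algebra_simps)
    then show ?thesis using bounds[of t x] t False by (auto simp: dist_real_def)
  qed
  moreover have "0 < \<delta>" using r s by (simp add: \<delta>_def)
  ultimately show "\<exists>d>0. \<forall>t. norm (t - x) < d \<longrightarrow>
      norm (F t - F x - f x * (t - x)) \<le> e * norm (t - x)"
    by blast
qed

theorem theorem2p3:
  fixes a b :: real and S :: "real set" and f F :: "real \<Rightarrow> real"
  assumes "a < b"
    and "piecewise_continuous_on a b S f"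
    and "continuous_on {a..b} F"
    and "\<forall>x\<in>{a..b} - S. has_specular_derivative_on a b F (f x) x"
  shows "(f has_integral (F b - F a)) {a..b}"
proof -
  have fin: "finite S" and contf: "continuous_on ({a..b} - S) f"
    using assms(2) by (auto simp: piecewise_continuous_on_def)
  \<comment> \<open>Removing the endpoints leaves only the two-sided case of the specular
    derivative; removing the finite, hence closed, set \<open>S\<close> keeps \<open>U\<close>
    open.\<close>
  define U where "U = {a<..<b} - S"
  have "open U" using fin by (simp add: U_def open_Diff finite_imp_closed)
  have "U \<subseteq> {a..b} - S" by (auto simp: U_def)
  then have contU: "continuous_on U f" "continuous_on U F"
    using contf assms(3) by (auto intro: continuous_on_subset)
  have deriv: "\<exists>\<alpha> \<beta>. has_right_specular_derivative F \<alpha> t \<and>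
      has_left_specular_derivative F \<beta> t \<and> f t = specular_slope \<alpha> \<beta>" if "t \<in> U" for t
  proof -
    have "has_specular_derivative_on a b F (f t) t"
      using assms(4) that \<open>U \<subseteq> _\<close> by blast
    then show ?thesis using that by (auto simp: has_specular_derivative_on_def U_def)
  qed
  show ?thesis
  \<comment> \<open>This form of the classical theorem asks for the derivative only at interior
    points outside the finite set \<open>S\<close>; continuity of \<open>F\<close> bridges the
    exceptional points.\<close>
  proof (rule fundamental_theorem_of_calculus_interior_strong[OF fin _ _ assms(3)])
    fix x assume x: "x \<in> {a<..<b} - S"
    then have "x \<in> U" by (simp add: U_def)
    moreover have "isCont f x"
      using contU(1) \<open>open U\<close> \<open>x \<in> U\<close> by (simp add: continuous_on_eq_continuous_at)
    ultimately show "(F has_vector_derivative f x) (at x)"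
      using has_real_derivative_if_continuous_specular_derivative[OF \<open>open U\<close> _ contU(2) _ deriv]
      by (simp add: has_real_derivative_iff_has_vector_derivative)
  qed (use \<open>a < b\<close> in simp)
qed

end
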